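(* Suppose that for every $j\in\mathcal J$ the ambiguity set $\mathcal P_j$ is the type-$\infty$ Wasserstein ambiguity set $$\mathcal P_j=\big\{\mathbb P:\ \mathbb P\{\tilde\omega_j\in\Xi_j\}=1,\ W_\infty(\mathbb P,\widehat{\mathbb P}_N^j)\le\delta_j\big\}.$$ Then for all $j\in\mathcal J$ and $t\in\mathcal T$: (a) the parameter $\psi_{jt}=\sup_{\mathbb P\in\mathcal P_j}\mathbb E_{\mathbb P}[\alpha(\tilde\omega_j,t)]$ can be computed as $\psi_{jt}=\frac1N\sum_{i\in\mathcal N}\theta_{ijt}$, where $$\theta_{ijt}=\max\Big\{\big(C_j^{pr}+V_j^{pr}(\min\{\omega_j^i+\delta_j,\max\Xi_j\}-t)\big)\,\mathbb I(t<\omega_j^i+\delta_j),\ \big(C_j^{co}+V_j^{co}(t-\max\{\omega_j^i-\delta_j,0\})\big)\,\mathbb I(\omega_j^i-\delta_j\le t)\Big\};$$ (b) the parameter $u_{jt}=\mathbb I\big[\inf_{\mathbb P\in\mathcal P_j}\mathbb P\{[t-\tilde\omega_j]_+\le\rho\}\ge1-\epsilon\big]$ can be computed as $$u_{jt}=\mathbb I\Big[\frac1N\sum_{i\in\mathcal N}\mathbb I\big\{[t-\max(\omega_j^i-\delta_j,0)]_+\le\rho\big\}\ge1-\epsilon\Big];$$ (c) the parameter $\bar p_{jt}=\sup_{\mathbb P\in\mathcal P_j}\mathbb P(\tilde\omega_j\le t)$ can be computed as $$\bar p_{jt}=\frac1N\sum_{i\in\mathcal N}\mathbb I(\omega_j^i-\delta_j\le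 t).$$
   Context: $\mathcal J=\{1,\dots,J\}$ is a set of components, $\mathcal T=\{1,\dots,T_{max}\}$ is a set of maintenance epochs, and $\mathcal N=\{1,\dots,N\}$ indexes samples. For each $j\in\mathcal J$, the remaining lifetime $\tilde\omega_j$ of component $j$ is a non-negative random variable with support $\Xi_j=[0,\tau_j^{\max}]\subseteq\mathbb R_+$; $\omega_j^1,\dots,\omega_j^N$ are $N$ independent remaining lifetime samples generated from an estimate of the distribution of $\tilde\omega_j$; $\widehat{\mathbb P}_N^j(\tilde\omega_j)=\frac1N\sum_{i\in\mathcal N}\mathbb I(\tilde\omega_j=\omega_j^i)$ is the corresponding empirical distribution (mass $1/N$ at each sample); and $\delta_j\ge0$ is a given radius. The $\infty$-Wasserstein distance is $$W_\infty(\mathbb P_1,\mathbb P_2)=\inf_{\mathrm Q}\big\{\mathrm{ess.sup}\,\|\tilde\omega_1-\tilde\omega_2\|:\ \mathrm Q\text{ is a joint distribution of }\tilde\omega_1\text{ and }\tilde\omega_2\text{ with marginals }\mathbb P_1\text{ and }\mathbb P_2\text{, respectively}\big\},$$ where the norm on $\mathbb R$ is the absolute value. $\mathbb I$ denotes the indicator function and $[\cdot]_+=\max(0,\cdot)$. The constant $\rho$ is the threshold on the maximum downtime of each component, and $1-\epsilon$ is the probability with which this threshold is required to be respected. For component $j$, $C_j^{pr}$ and $C_j^{co}$ are the fixed preventive and corrective maintenance costs, $V_j^{pr}$ and $V_j^{co}$ are the variable costs of premature and late repair, and $$\alpha(\tilde\omega_j,t)=\big(V_j^{pr}(\tilde\omega_j-t)+C_j^{pr}\big)\mathbb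 I\{\tilde\omega_j>t\}+\big(V_j^{co}(t-\tilde\omega_j)+C_j^{co}\big)\mathbb I\{\tilde\omega_j\le t\}$$ is the maintenance cost of repairing component $j$ at time $t$.
   Formalization: Costs are taken nonnegative, samples lie in Ξ_j, and C_j^pr ≤ C_j^co is assumed whenever some epoch t and sample i satisfy max Ξ_j ≤ t < ω_j^i+δ_j; otherwise (a) can fail (N=1, max Ξ=ω=δ=t=1, V^pr=V^co=0, C^pr=2, C^co=1: ψ=1, θ=2). *)

theory Defs
  imports "HOL-Probability.Probability" "HOL-Probability.Essential_Supremum"
begin

text \<open>A lifetime distribution is a Borel probability measure on \<open>\<real>\<close>; the random variable itself is
  the identity on that space.\<close>

definition couplings :: "real measure \<Rightarrow> real measure \<Rightarrow> (real \<times> real) measure set" where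
  "couplings P1 P2 =
     {Q. prob_space Q \<and> sets Q = sets (borel \<Otimes>\<^sub>M borel)
         \<and> distr Q borel fst = P1 \<and> distr Q borel snd = P2}"

text \<open>Extended-real valued, since an essential supremum can be infinite; over the real numbers the
  infimum and the essential supremum would be unspecified there.\<close>

definition W_infinity :: "real measure \<Rightarrow> real measure \<Rightarrow> ereal" where
  "W_infinity P1 P2 =
     (INF Q\<in>couplings P1 P2. esssup Q (\<lambda>(x, y). ereal \<bar>x - y\<bar>))"

definition empirical :: "nat \<Rightarrow> (nat \<Rightarrow> real) \<Rightarrow> real measure" where
  "empirical N x = distr (uniform_count_measure {1..N}) borel x"

text \<open>Repeated sample values accumulate mass.\<close>

lemma measure_empirical:
  assumes "A \<in> sets borel"
  shows "measure (empirical N x) A = (\<Sum>i = 1..N. indicator A (x i)) / real N"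
proof -
  have "measure (empirical N x) A
      = measure (uniform_count_measure {1..N}) {i \<in> {1..N}. x i \<in> A}"
    unfolding empirical_def using assms
    by (subst measure_distr)
       (auto simp: space_uniform_count_measure sets_uniform_count_measure
         measurable_def intro!: arg_cong[where f = "measure _"])
  also have "\<dots> = real (card {i \<in> {1..N}. x i \<in> A}) / real N"
    by (subst measure_uniform_count_measure) auto
  also have "real (card {i \<in> {1..N}. x i \<in> A}) = (\<Sum>i = 1..N. indicator A (x i))"
    by (simp add: indicator_def sum.If_cases Int_def)
  finally show ?thesis .
qed

definition wasserstein_ambiguity_set ::
    "real set \<Rightarrow> nat \<Rightarrow> (nat \<Rightarrow> real) \<Rightarrow> real \<Rightarrow> real measure set" where
  "wasserstein_ambiguity_set \<Xi> N x \<delta> =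
     {P. prob_space P \<and> sets P = sets borel \<and> measure P \<Xi> = 1
         \<and> W_infinity P (empirical N x) \<le> ereal \<delta>}"

definition maintenance_cost ::
    "real \<Rightarrow> real \<Rightarrow> real \<Rightarrow> real \<Rightarrow> real \<Rightarrow> real \<Rightarrow> real" where
  "maintenance_cost Vpr Vco Cpr Cco w t =
     (Vpr * (w - t) + Cpr) * of_bool (w > t) + (Vco * (t - w) + Cco) * of_bool (w \<le> t)"

end

theory Submission
  imports Defs
begin

text \<open>
  Under a coupling with the empirical distribution, the mass \<open>1/N\<close> carried by a sample \<open>y i\<close> may be
  redistributed over \<open>\<Xi> \<inter> [y i - \<delta>, y i + \<delta>]\<close> independently of the other samples. Hence the worst-case
  expectation of \<open>f\<close> is the average over the samples of the local suprema of \<open>f\<close> on these sets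
  (\<open>SUP_integral_wasserstein_ball\<close>). All three quantities are of this form, with \<open>f\<close> the maintenance
  cost, a negated indicator, or an indicator, and in each case the local supremum is attained at an
  endpoint of the truncated interval. That an average of local suprema is reached is shown by moving
  each sample to its maximiser (\<open>empirical_in_wasserstein_ambiguity_set\<close>).

  The upper bound (\<open>integral_le_over_wasserstein_ball\<close>) is delicate because the distance is an infimum
  over couplings and the maintenance cost may jump upwards just after \<open>t\<close>, so that enlarging the
  radius slightly may change the local suprema by a fixed amount. What is used instead is that the
  distribution itself gives vanishing mass to the shrinking annuli around the intervals.
\<close>

section \<open>Empirical distributions and their perturbations\<close>

lemma sets_empirical [measurable_cong, simp]: "sets (empirical N x) = sets borel"
  by (simp add: empirical_def)

lemma measurable_uniform_count_measure [simp]: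
  "x \<in> measurable (uniform_count_measure A) M \<longleftrightarrow> x \<in> A \<rightarrow> space M"
  by (auto simp: measurable_def sets_uniform_count_measure space_uniform_count_measure)

lemma prob_space_empirical:
  assumes "N \<ge> 1"
  shows "prob_space (empirical N x)"
  unfolding empirical_def using assms
  by (intro prob_space.prob_space_distr prob_space_uniform_count_measure) auto

lemma integral_empirical:
  fixes f :: "real \<Rightarrow> real"
  assumes "f \<in> borel_measurable borel"
  shows "(\<integral>w. f w \<partial>empirical N x) = (\<Sum>i = 1..N. f (x i)) / real N"
  unfolding empirical_def using assms
  by (subst integral_distr) (auto simp: integral_uniform_count_measure)

lemma AE_empirical:
  assumes "N \<ge> 1" and "S \<in> sets borel" and "\<And>i. i \<in> {1..N} \<Longrightarrow> x i \<in> S"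
  shows "AE w in empirical N x. w \<in> S"
proof -
  interpret prob_space "empirical N x"
    by (rule prob_space_empirical[OF assms(1)])
  have "prob S = 1"
    using assms by (simp add: measure_empirical)
  then show ?thesis
    using assms(2) by (subst (asm) prob_eq_1) auto
qed

text \<open>Moving every sample by at most \<open>\<delta>\<close> inside \<open>\<Xi>\<close> stays in the ambiguity set: pairing each
  moved sample with its original is a coupling.\<close>

lemma empirical_in_wasserstein_ambiguity_set:
  assumes N: "N \<ge> 1" and \<Xi>: "\<Xi> \<in> sets borel"
    and x: "\<And>i. i \<in> {1..N} \<Longrightarrow> x i \<in> \<Xi>"
    and close: "\<And>i. i \<in> {1..N} \<Longrightarrow> \<bar>x i - y i\<bar> \<le> \<delta>"
  shows "empirical N x \<in> wasserstein_ambiguity_set \<Xi> N y \<delta>"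
proof -
  let ?U = "uniform_count_measure {1..N}"
  let ?Q = "distr ?U (borel \<Otimes>\<^sub>M borel) (\<lambda>i. (x i, y i))"
  have m: "(\<lambda>i. (x i, y i)) \<in> measurable ?U (borel \<Otimes>\<^sub>M borel)"
    by (simp add: space_pair_measure)
  have "prob_space ?Q"
    using N m by (intro prob_space.prob_space_distr prob_space_uniform_count_measure) auto
  moreover have "distr ?Q borel fst = empirical N x" "distr ?Q borel snd = empirical N y"
    unfolding empirical_def by (subst distr_distr; simp add: m comp_def space_pair_measure)+
  ultimately have Q: "?Q \<in> couplings (empirical N x) (empirical N y)"
    by (simp add: couplings_def)
  have meas: "(\<lambda>(a, b). ereal \<bar>a - b\<bar>) \<in> borel_measurable (borel \<Otimes>\<^sub>M borel :: (real \<times> real) measure)"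
    by measurable
  have "AE i in ?U. \<bar>x i - y i\<bar> \<le> \<delta>"
    by (rule AE_I2) (use close in \<open>simp add: space_uniform_count_measure\<close>)
  then have "AE p in ?Q. (case p of (a, b) \<Rightarrow> ereal \<bar>a - b\<bar>) \<le> ereal \<delta>"
    by (subst AE_distr_iff[OF m]) auto
  then have "esssup ?Q (\<lambda>(a, b). ereal \<bar>a - b\<bar>) \<le> ereal \<delta>"
    using meas by (intro esssup_I) simp_all
  with Q have "W_infinity (empirical N x) (empirical N y) \<le> ereal \<delta>"
    unfolding W_infinity_def by (rule INF_lower2)
  moreover have "measure (empirical N x) \<Xi> = 1"
    using x N \<Xi> by (simp add: measure_empirical)
  ultimately show ?thesis
    using prob_space_empirical[OF N] by (simp add: wasserstein_ambiguity_set_def)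
qed

section \<open>Expectations over the Wasserstein ball\<close>

text \<open>The infimum defining the distance provides only couplings whose displacement is almost surely
  at most \<open>\<delta> + 1/n\<close>, so mass may sit in the annulus of points whose distance to a sample lies in
  \<open>(\<delta>, \<delta> + 1/n]\<close>, where the pointwise bound by \<open>\<theta>\<close> is not available. For the fixed distribution \<open>P\<close> these
  annuli decrease to the empty set, hence their contribution vanishes as \<open>n\<close> grows. This needs
  neither an optimal coupling nor any semicontinuity of \<open>f\<close>.\<close>

lemma integral_le_over_wasserstein_ball:
  fixes f \<theta> :: "real \<Rightarrow> real"
  assumes N: "N \<ge> 1" and \<Xi>: "\<Xi> \<in> sets borel"
    and f: "f \<in> borel_measurable borel" and \<theta>: "\<theta> \<in> borel_measurable borel"
    and bounded: "\<And>w. w \<in> \<Xi> \<Longrightarrow> \<bar>f w\<bar> \<le> M"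
    and dominated: "\<And>i w. i \<in> {1..N} \<Longrightarrow> w \<in> \<Xi> \<Longrightarrow> \<bar>w - y i\<bar> \<le> \<delta> \<Longrightarrow> f w \<le> \<theta> (y i)"
    and P: "P \<in> wasserstein_ambiguity_set \<Xi> N y \<delta>"
  shows "(\<integral>w. f w \<partial>P) \<le> (\<Sum>i = 1..N. \<theta> (y i)) / real N"
proof -
  define A where "A n i = {w. \<delta> < \<bar>w - y i\<bar> \<and> \<bar>w - y i\<bar> \<le> \<delta> + 1 / real (Suc n)}" for n i
  define L where "L = (\<Sum>i = 1..N. \<bar>\<theta> (y i)\<bar>)"
  \<comment> \<open>\<open>K\<close> bounds \<open>f w - \<theta> (y i)\<close> on all of \<open>\<Xi>\<close>, in particular on the annuli.\<close>
  define K where "K = \<bar>M\<bar> + L"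
  have [simp]: "sets P = sets borel" and "prob_space P" and P\<Xi>: "measure P \<Xi> = 1"
    and W: "W_infinity P (empirical N y) \<le> ereal \<delta>"
    using P by (auto simp: wasserstein_ambiguity_set_def)
  interpret P: prob_space P by fact
  have [simp]: "space P = UNIV"
    using sets_eq_imp_space_eq[of P borel] by simp
  have A [measurable]: "A n i \<in> sets borel" for n i
    unfolding A_def by measurable
  have L: "\<bar>\<theta> (y i)\<bar> \<le> L" if "i \<in> {1..N}" for i
    unfolding L_def using that by (intro member_le_sum) auto
  have "0 \<le> L" unfolding L_def by (intro sum_nonneg) auto
  have "AE w in P. w \<in> \<Xi>"
    using P\<Xi> \<Xi> by (subst (asm) P.prob_eq_1) auto
  have step: "(\<integral>w. f w \<partial>P) \<le>
      (\<Sum>i = 1..N. \<theta> (y i)) / real N + K * (\<Sum>i = 1..N. measure P (A n i))" for n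
  proof -
    have "W_infinity P (empirical N y) < ereal (\<delta> + 1 / real (Suc n))"
      using W by (rule le_less_trans) simp
    then obtain Q where "Q \<in> couplings P (empirical N y)"
      and ess: "esssup Q (\<lambda>(a, b). ereal \<bar>a - b\<bar>) < ereal (\<delta> + 1 / real (Suc n))"
      unfolding W_infinity_def INF_less_iff by blast
    then have "prob_space Q" and sQ [measurable_cong]: "sets Q = sets (borel \<Otimes>\<^sub>M borel)"
      and Q1: "distr Q borel fst = P" and Q2: "distr Q borel snd = empirical N y"
      by (auto simp: couplings_def)
    interpret Q: prob_space Q by fact
    have m1 [measurable]: "fst \<in> measurable Q borel" and m2 [measurable]: "snd \<in> measurable Q borel"
      by measurable
    from esssup_AE[of "\<lambda>(a, b). ereal \<bar>a - b\<bar>" Q]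
    have near: "AE p in Q. \<bar>fst p - snd p\<bar> \<le> \<delta> + 1 / real (Suc n)"
    proof eventually_elim
      case (elim p)
      then have "ereal \<bar>fst p - snd p\<bar> < ereal (\<delta> + 1 / real (Suc n))"
        using le_less_trans[OF elim ess] by (simp only: case_prod_beta)
      then show ?case by simp
    qed
    have in\<Xi>: "AE p in Q. fst p \<in> \<Xi>"
      using \<open>AE w in P. w \<in> \<Xi>\<close> \<Xi> unfolding Q1[symmetric] by (subst (asm) AE_distr_iff) auto
    have "AE v in empirical N y. v \<in> y ` {1..N}"
      using N by (intro AE_empirical) (auto intro!: borel_closed finite_imp_closed)
    then have sample: "AE p in Q. snd p \<in> y ` {1..N}"
      unfolding Q2[symmetric] by (subst (asm) AE_distr_iff) (auto intro!: borel_closed finite_imp_closed)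
    have int_f: "integrable Q (\<lambda>p. f (fst p))"
      by (rule Q.integrable_const_bound[where B = M]) (use in\<Xi> bounded f in auto)
    have int_\<theta>: "integrable Q (\<lambda>p. \<theta> (snd p))"
      by (rule Q.integrable_const_bound[where B = L]) (use sample L \<theta> in auto)
    have int_A: "integrable Q (\<lambda>p. indicator (A n i) (fst p) :: real)" for i
      by (rule Q.integrable_const_bound[where B = 1]) auto
    have mass_A: "(\<integral>p. indicator (A n i) (fst p) \<partial>Q) = measure P (A n i)" for i
    proof -
      have "(\<integral>p. indicator (A n i) (fst p) \<partial>Q) = (\<integral>w. indicator (A n i) w \<partial>P :: real)"
        unfolding Q1[symmetric] by (subst integral_distr) auto
      then show ?thesis by simp
    qed
    have mean_\<theta>: "(\<integral>p. \<theta> (snd p) \<partial>Q) = (\<Sum>i = 1..N. \<theta> (y i)) / real N"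
    proof -
      have "(\<integral>p. \<theta> (snd p) \<partial>Q) = (\<integral>v. \<theta> v \<partial>empirical N y)"
        unfolding Q2[symmetric] using \<theta> by (subst integral_distr) auto
      then show ?thesis by (simp add: integral_empirical[OF \<theta>])
    qed
    have "(\<integral>w. f w \<partial>P) = (\<integral>p. f (fst p) \<partial>Q)"
      unfolding Q1[symmetric] using f by (subst integral_distr) auto
    also have "\<dots> \<le> (\<integral>p. \<theta> (snd p) + K * (\<Sum>i = 1..N. indicator (A n i) (fst p)) \<partial>Q)"
    proof (rule integral_mono_AE)
      show "AE p in Q. f (fst p) \<le> \<theta> (snd p) + K * (\<Sum>i = 1..N. indicator (A n i) (fst p))"
        using near in\<Xi> sample
      proof eventually_elim
        case (elim p)
        then obtain i where i: "i \<in> {1..N}" "snd p = y i" by auto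
        have nonneg: "0 \<le> K * (\<Sum>k = 1..N. indicator (A n k) (fst p))"
          using \<open>0 \<le> L\<close> by (auto simp: K_def intro!: mult_nonneg_nonneg sum_nonneg)
        show ?case
        proof (cases "\<bar>fst p - y i\<bar> \<le> \<delta>")
          case True
          then show ?thesis using dominated[OF i(1), of "fst p"] elim i nonneg by simp
        next
          case False
          then have "1 = indicator (A n i) (fst p)"
            using elim i by (simp add: A_def)
          also have "\<dots> \<le> (\<Sum>k = 1..N. indicator (A n k) (fst p) :: real)"
            using i(1) by (intro member_le_sum) auto
          finally have "K * 1 \<le> K * (\<Sum>k = 1..N. indicator (A n k) (fst p))"
            using \<open>0 \<le> L\<close> by (intro mult_left_mono) (auto simp: K_def)
          moreover have "f (fst p) \<le> \<theta> (y i) + K"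
            using bounded[of "fst p"] elim L[OF i(1)] by (auto simp: K_def)
          ultimately show ?thesis using i by simp
        qed
      qed
    qed (use int_f int_\<theta> int_A in auto)
    also have "\<dots> = (\<integral>p. \<theta> (snd p) \<partial>Q)
        + K * (\<Sum>i = 1..N. (\<integral>p. indicator (A n i) (fst p) \<partial>Q))"
      using int_\<theta> int_A by simp
    also have "\<dots> = (\<Sum>i = 1..N. \<theta> (y i)) / real N + K * (\<Sum>i = 1..N. measure P (A n i))"
      by (simp only: mean_\<theta> mass_A)
    finally show ?thesis .
  qed
  have "(\<lambda>n. measure P (A n i)) \<longlonglongrightarrow> 0" for i
  proof -
    have "(\<Inter>n. A n i) = {}"
    proof -
      have False if "w \<in> (\<Inter>n. A n i)" for w
      proof -
        have "0 < \<bar>w - y i\<bar> - \<delta>" using that by (auto simp: A_def)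
        then obtain n where "1 / real (Suc n) < \<bar>w - y i\<bar> - \<delta>"
          by (rule nat_approx_posE)
        moreover have "w \<in> A n i" using that by blast
        ultimately show False by (simp add: A_def)
      qed
      then show ?thesis by blast
    qed
    moreover have range_A: "range (\<lambda>n. A n i) \<subseteq> sets P"
      using A by (simp add: image_subset_iff)
    moreover have "decseq (\<lambda>n. A n i)"
    proof (rule decseq_SucI, rule subsetI)
      fix n w assume "w \<in> A (Suc n) i"
      moreover have "1 / real (Suc (Suc n)) \<le> 1 / real (Suc n)"
        by (intro divide_left_mono) auto
      ultimately show "w \<in> A n i" by (auto simp: A_def)
    qed
    ultimately show ?thesis
      using P.finite_Lim_measure_decseq[OF range_A] by simp
  qed
  then have lim: "(\<lambda>n. (\<Sum>i = 1..N. \<theta> (y i)) / real N + K * (\<Sum>i = 1..N. measure P (A n i)))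
      \<longlonglongrightarrow> (\<Sum>i = 1..N. \<theta> (y i)) / real N + K * (\<Sum>i = 1..N. 0)"
    by (intro tendsto_intros)
  show ?thesis
    using LIMSEQ_le_const[OF lim] step by simp
qed

text \<open>Here \<open>\<theta> (y i)\<close> is the maximum of \<open>f\<close> over \<open>\<Xi> \<inter> [y i - \<delta>, y i + \<delta>]\<close>; the empirical distribution
  of the maximisers is a worst case.\<close>

lemma SUP_integral_wasserstein_ball:
  fixes f \<theta> :: "real \<Rightarrow> real"
  assumes N: "N \<ge> 1" and \<Xi>: "\<Xi> \<in> sets borel"
    and f: "f \<in> borel_measurable borel" and \<theta>: "\<theta> \<in> borel_measurable borel"
    and bounded: "\<And>w. w \<in> \<Xi> \<Longrightarrow> \<bar>f w\<bar> \<le> M"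
    and dominated: "\<And>i w. i \<in> {1..N} \<Longrightarrow> w \<in> \<Xi> \<Longrightarrow> \<bar>w - y i\<bar> \<le> \<delta> \<Longrightarrow> f w \<le> \<theta> (y i)"
    and attained: "\<And>i. i \<in> {1..N} \<Longrightarrow> \<exists>x\<in>\<Xi>. \<bar>x - y i\<bar> \<le> \<delta> \<and> f x = \<theta> (y i)"
  shows "(SUP P\<in>wasserstein_ambiguity_set \<Xi> N y \<delta>. ereal (\<integral>w. f w \<partial>P))
    = ereal ((\<Sum>i = 1..N. \<theta> (y i)) / real N)"
proof (rule antisym)
  show "(SUP P\<in>wasserstein_ambiguity_set \<Xi> N y \<delta>. ereal (\<integral>w. f w \<partial>P))
      \<le> ereal ((\<Sum>i = 1..N. \<theta> (y i)) / real N)"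
    using integral_le_over_wasserstein_ball[OF N \<Xi> f \<theta> bounded dominated]
    by (intro SUP_least) simp
next
  obtain x where x: "\<And>i. i \<in> {1..N} \<Longrightarrow> x i \<in> \<Xi> \<and> \<bar>x i - y i\<bar> \<le> \<delta> \<and> f (x i) = \<theta> (y i)"
    using attained by metis
  have "(\<integral>w. f w \<partial>empirical N x) = (\<Sum>i = 1..N. \<theta> (y i)) / real N"
    using x by (simp add: integral_empirical[OF f])
  moreover have "empirical N x \<in> wasserstein_ambiguity_set \<Xi> N y \<delta>"
    using x by (intro empirical_in_wasserstein_ambiguity_set N \<Xi>) auto
  ultimately show "ereal ((\<Sum>i = 1..N. \<theta> (y i)) / real N)
      \<le> (SUP P\<in>wasserstein_ambiguity_set \<Xi> N y \<delta>. ereal (\<integral>w. f w \<partial>P))"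
    by (intro SUP_upper2) auto
qed

section \<open>The worst-case maintenance cost of a sample\<close>

text \<open>The candidate for the local supremum of the maintenance cost over
  \<open>[0, \<tau>] \<inter> [y - \<delta>, y + \<delta>]\<close>. For nonnegative rates the cost is nonincreasing in the lifetime up to \<open>t\<close>
  and nondecreasing after \<open>t\<close>, so only the right end (premature repair) and the left end (late
  repair) compete. The indicators test the ends before truncation to \<open>[0, \<tau>]\<close>; an entry whose
  indicator vanishes counts as \<open>0\<close>, which is harmless when the costs are nonnegative.\<close>

definition worst_cost :: "real \<Rightarrow> real \<Rightarrow> real \<Rightarrow> real \<Rightarrow> real \<Rightarrow> real \<Rightarrow> real \<Rightarrow> real \<Rightarrow> real" where
  "worst_cost Vpr Vco Cpr Cco \<tau> \<delta> t y =
     max ((Cpr + Vpr * (min (y + \<delta>) \<tau> - t)) * of_bool (t < y + \<delta>))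
         ((Cco + Vco * (t - max (y - \<delta>) 0)) * of_bool (y - \<delta> \<le> t))"

lemma maintenance_cost_le_worst_cost:
  assumes nonneg: "Vpr \<ge> 0" "Vco \<ge> 0" "Cpr \<ge> 0" "Cco \<ge> 0"
    and w: "w \<in> {0..\<tau>}" "\<bar>w - y\<bar> \<le> \<delta>"
  shows "maintenance_cost Vpr Vco Cpr Cco w t \<le> worst_cost Vpr Vco Cpr Cco \<tau> \<delta> t y"
proof (cases "w > t")
  case True
  then have "Vpr * (w - t) \<le> Vpr * (min (y + \<delta>) \<tau> - t)"
    using nonneg w by (intro mult_left_mono) auto
  moreover have "t < y + \<delta>" using True w by auto
  ultimately show ?thesis using True by (simp add: maintenance_cost_def worst_cost_def)
next
  case False
  then have "Vco * (t - w) \<le> Vco * (t - max (y - \<delta>) 0)"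
    using nonneg w by (intro mult_left_mono) auto
  moreover have "y - \<delta> \<le> t" using False w by auto
  ultimately show ?thesis using False by (simp add: maintenance_cost_def worst_cost_def)
qed

text \<open>The hypothesis comparing \<open>Cpr\<close> and \<open>Cco\<close> concerns a repair time \<open>t \<ge> \<tau>\<close> with \<open>t < y + \<delta>\<close>. Then the
  indicator of the first entry is \<open>1\<close> although every lifetime in \<open>[0, \<tau>]\<close> is repaired late, so the second
  entry must dominate the first for the maximum to be attained.\<close>

lemma worst_cost_attained:
  assumes nonneg: "Vpr \<ge> 0" "Vco \<ge> 0" "Cpr \<ge> 0" "Cco \<ge> 0"
    and y: "y \<in> {0..\<tau>}" and "\<delta> \<ge> 0" and t: "t \<ge> 0"
    and order: "\<tau> \<le> t \<Longrightarrow> t < y + \<delta> \<Longrightarrow> Cpr \<le> Cco"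
  shows "\<exists>x\<in>{0..\<tau>}. \<bar>x - y\<bar> \<le> \<delta> \<and>
    maintenance_cost Vpr Vco Cpr Cco x t = worst_cost Vpr Vco Cpr Cco \<tau> \<delta> t y"
proof -
  let ?r = "min (y + \<delta>) \<tau>" and ?l = "max (y - \<delta>) 0"
  let ?a = "Cpr + Vpr * (?r - t)" and ?b = "Cco + Vco * (t - ?l)"
  have r: "?r \<in> {0..\<tau>}" "\<bar>?r - y\<bar> \<le> \<delta>" and l: "?l \<in> {0..\<tau>}" "\<bar>?l - y\<bar> \<le> \<delta>"
    using y \<open>\<delta> \<ge> 0\<close> by auto
  have cost_r: "maintenance_cost Vpr Vco Cpr Cco ?r t = ?a" if "t < ?r"
    unfolding maintenance_cost_def using that by (simp del: min_less_iff_conj)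
  have cost_l: "maintenance_cost Vpr Vco Cpr Cco ?l t = ?b" if "y - \<delta> \<le> t"
    proof -
    have "?l \<le> t" using that t by simp
    then show ?thesis by (simp add: maintenance_cost_def del: max.bounded_iff)
  qed
  have a: "0 \<le> ?a" if "t < ?r"
    using that nonneg by (intro add_nonneg_nonneg mult_nonneg_nonneg) auto
  have b: "Cco \<le> ?b" if "y - \<delta> \<le> t"
    using that nonneg t by (intro iffD2[OF le_add_same_cancel1] mult_nonneg_nonneg) auto
  \<comment> \<open>In \<open>pre\<close> the right end is optimal, in all other cases the left end; \<open>late\<close> needs \<open>y - \<delta> \<le> t\<close>
    for the left end to be repaired late, which holds automatically in \<open>beyond\<close> and \<open>right\<close>.\<close>
  consider (pre) "t < ?r" "\<not> (y - \<delta> \<le> t \<and> ?a \<le> ?b)" | (late) "t < ?r" "y - \<delta> \<le> t" "?a \<le> ?b"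
    | (beyond) "\<tau> \<le> t" "t < y + \<delta>" | (right) "y + \<delta> \<le> t"
    by (metis min_less_iff_conj not_le)
  then show ?thesis
  proof cases
    case pre
    then have "worst_cost Vpr Vco Cpr Cco \<tau> \<delta> t y = ?a"
      using a by (auto simp: worst_cost_def)
    with pre r cost_r show ?thesis by metis
  next
    case late
    then have "worst_cost Vpr Vco Cpr Cco \<tau> \<delta> t y = ?b"
      by (simp add: worst_cost_def)
    with late l cost_l show ?thesis by metis
  next
    case beyond
    then have "y - \<delta> \<le> t" using y \<open>\<delta> \<ge> 0\<close> by auto
    moreover have "Vpr * (?r - t) \<le> 0"
      using nonneg beyond by (intro mult_nonneg_nonpos) auto
    then have "?a \<le> ?b"
      using b order beyond \<open>y - \<delta> \<le> t\<close> by linarith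
    ultimately have "worst_cost Vpr Vco Cpr Cco \<tau> \<delta> t y = ?b"
      using beyond by (simp add: worst_cost_def)
    with \<open>y - \<delta> \<le> t\<close> l cost_l show ?thesis by metis
  next
    case right
    then have "y - \<delta> \<le> t" using \<open>\<delta> \<ge> 0\<close> by auto
    then have "worst_cost Vpr Vco Cpr Cco \<tau> \<delta> t y = ?b"
      using right b nonneg by (simp add: worst_cost_def)
    with \<open>y - \<delta> \<le> t\<close> l cost_l show ?thesis by metis
  qed
qed

lemma abs_maintenance_cost_le:
  assumes nonneg: "Vpr \<ge> 0" "Vco \<ge> 0" "Cpr \<ge> 0" "Cco \<ge> 0"
    and "w \<in> {0..\<tau>}" "t \<ge> 0"
  shows "\<bar>maintenance_cost Vpr Vco Cpr Cco w t\<bar> \<le> Vpr * \<tau> + Cpr + Vco * t + Cco"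
proof -
  have "Vpr * (w - t) \<le> Vpr * \<tau>" "Vco * (t - w) \<le> Vco * t"
    using assms by (auto intro!: mult_left_mono)
  moreover have "0 \<le> Vpr * \<tau>" "0 \<le> Vco * t"
    using assms by auto
  moreover have "0 \<le> Vpr * (w - t)" if "t < w" using that nonneg by simp
  moreover have "0 \<le> Vco * (t - w)" if "w \<le> t" using that nonneg by simp
  ultimately show ?thesis
    using nonneg by (cases "w > t") (auto simp: maintenance_cost_def)
qed

section \<open>Worst-case cost, downtime and failure probability\<close>

theorem proposition5:
  fixes J T_max N :: nat
    and \<tau> \<delta> V_pr V_co C_pr C_co :: "nat \<Rightarrow> real"
    and \<omega> :: "nat \<Rightarrow> nat \<Rightarrow> real"
    and \<rho> \<epsilon> :: real
    and \<P> :: "nat \<Rightarrow> real measure set"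
  assumes N: "N \<ge> 1"
    and samples: "\<And>j i. j \<in> {1..J} \<Longrightarrow> i \<in> {1..N} \<Longrightarrow> \<omega> j i \<in> {0..\<tau> j}"
    and radius: "\<And>j. j \<in> {1..J} \<Longrightarrow> \<delta> j \<ge> 0"
    and costs_nonneg: "\<And>j. j \<in> {1..J} \<Longrightarrow> V_pr j \<ge> 0 \<and> V_co j \<ge> 0 \<and> C_pr j \<ge> 0 \<and> C_co j \<ge> 0"
    and costs_order: "\<And>j t i. j \<in> {1..J} \<Longrightarrow> t \<in> {1..T_max} \<Longrightarrow> i \<in> {1..N} \<Longrightarrow>
        \<tau> j \<le> real t \<Longrightarrow> real t < \<omega> j i + \<delta> j \<Longrightarrow> C_pr j \<le> C_co j"
    and ambiguity: "\<And>j. j \<in> {1..J} \<Longrightarrow>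
        \<P> j = wasserstein_ambiguity_set {0..\<tau> j} N (\<omega> j) (\<delta> j)"
  shows "\<forall>j\<in>{1..J}. \<forall>t\<in>{1..T_max}.
      (SUP P\<in>\<P> j. ereal (\<integral>w. maintenance_cost (V_pr j) (V_co j) (C_pr j) (C_co j) w (real t) \<partial>P))
        = ereal ((\<Sum>i = 1..N.
            max ((C_pr j + V_pr j * (min (\<omega> j i + \<delta> j) (\<tau> j) - real t))
                   * of_bool (real t < \<omega> j i + \<delta> j))
                ((C_co j + V_co j * (real t - max (\<omega> j i - \<delta> j) 0))
                   * of_bool (\<omega> j i - \<delta> j \<le> real t))) / real N)
    \<and> (of_bool ((INF P\<in>\<P> j. ereal (measure P {w. max 0 (real t - w) \<le> \<rho>})) \<ge> ereal (1 - \<epsilon>)) :: real)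
        = of_bool ((\<Sum>i = 1..N. of_bool (max 0 (real t - max (\<omega> j i - \<delta> j) 0) \<le> \<rho>)) / real N
            \<ge> 1 - \<epsilon>)
    \<and> (SUP P\<in>\<P> j. ereal (measure P {w. w \<le> real t}))
        = ereal ((\<Sum>i = 1..N. of_bool (\<omega> j i - \<delta> j \<le> real t)) / real N)"
proof (intro ballI conjI)
  fix j t assume j: "j \<in> {1..J}" and t: "t \<in> {1..T_max}"
  let ?amb = "wasserstein_ambiguity_set {0..\<tau> j} N (\<omega> j) (\<delta> j)"
  let ?left = "\<lambda>y. max (y - \<delta> j) 0"
  have left: "?left (\<omega> j i) \<in> {0..\<tau> j}" "\<bar>?left (\<omega> j i) - \<omega> j i\<bar> \<le> \<delta> j"
    if "i \<in> {1..N}" for i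
    using samples[OF j that] radius[OF j] by auto
  have \<Xi>: "{0..\<tau> j} \<in> sets borel" by simp
  have nonneg: "V_pr j \<ge> 0" "V_co j \<ge> 0" "C_pr j \<ge> 0" "C_co j \<ge> 0"
    using costs_nonneg[OF j] by auto
  have sets_amb: "sets P = sets borel" "space P = UNIV" if "P \<in> ?amb" for P
    using that sets_eq_imp_space_eq[of P borel] by (auto simp: wasserstein_ambiguity_set_def)

  have "(SUP P\<in>?amb. ereal (\<integral>w. maintenance_cost (V_pr j) (V_co j) (C_pr j) (C_co j) w (real t) \<partial>P))
      = ereal ((\<Sum>i = 1..N. worst_cost (V_pr j) (V_co j) (C_pr j) (C_co j) (\<tau> j) (\<delta> j) (real t) (\<omega> j i)) / real N)"
  proof (rule SUP_integral_wasserstein_ball[OF N \<Xi>])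
    show "(\<lambda>w. maintenance_cost (V_pr j) (V_co j) (C_pr j) (C_co j) w (real t)) \<in> borel_measurable borel"
      unfolding maintenance_cost_def by measurable
    show "worst_cost (V_pr j) (V_co j) (C_pr j) (C_co j) (\<tau> j) (\<delta> j) (real t) \<in> borel_measurable borel"
      unfolding worst_cost_def by measurable
  next
    fix w assume "w \<in> {0..\<tau> j}"
    then show "\<bar>maintenance_cost (V_pr j) (V_co j) (C_pr j) (C_co j) w (real t)\<bar>
        \<le> V_pr j * \<tau> j + C_pr j + V_co j * real t + C_co j"
      using nonneg by (intro abs_maintenance_cost_le) auto
  next
    fix i w assume "w \<in> {0..\<tau> j}" "\<bar>w - \<omega> j i\<bar> \<le> \<delta> j"
    then show "maintenance_cost (V_pr j) (V_co j) (C_pr j) (C_co j) w (real t)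
        \<le> worst_cost (V_pr j) (V_co j) (C_pr j) (C_co j) (\<tau> j) (\<delta> j) (real t) (\<omega> j i)"
      using nonneg by (intro maintenance_cost_le_worst_cost) auto
  next
    fix i assume i: "i \<in> {1..N}"
    show "\<exists>x\<in>{0..\<tau> j}. \<bar>x - \<omega> j i\<bar> \<le> \<delta> j
        \<and> maintenance_cost (V_pr j) (V_co j) (C_pr j) (C_co j) x (real t)
          = worst_cost (V_pr j) (V_co j) (C_pr j) (C_co j) (\<tau> j) (\<delta> j) (real t) (\<omega> j i)"
      using nonneg samples[OF j i] radius[OF j] costs_order[OF j t i]
      by (intro worst_cost_attained) auto
  qed
  then show "(SUP P\<in>\<P> j. ereal (\<integral>w. maintenance_cost (V_pr j) (V_co j) (C_pr j) (C_co j) w (real t) \<partial>P))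
        = ereal ((\<Sum>i = 1..N.
            max ((C_pr j + V_pr j * (min (\<omega> j i + \<delta> j) (\<tau> j) - real t))
                   * of_bool (real t < \<omega> j i + \<delta> j))
                ((C_co j + V_co j * (real t - max (\<omega> j i - \<delta> j) 0))
                   * of_bool (\<omega> j i - \<delta> j \<le> real t))) / real N)"
    by (simp only: ambiguity[OF j] worst_cost_def)

  \<comment> \<open>The infimum of the probability is minus the supremum of the negated indicator's expectation.\<close>
  let ?S = "{w. max 0 (real t - w) \<le> \<rho>}"
  have S: "?S \<in> sets borel" by measurable
  have "(SUP P\<in>?amb. ereal (\<integral>w. - indicator ?S w \<partial>P))
      = ereal ((\<Sum>i = 1..N. - indicator ?S (?left (\<omega> j i))) / real N)"
  proof (rule SUP_integral_wasserstein_ball[OF N \<Xi>, where M = 1])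
    show "(\<lambda>w. - indicator ?S w :: real) \<in> borel_measurable borel"
      using S by measurable
    show "(\<lambda>y. - indicator ?S (?left y) :: real) \<in> borel_measurable borel"
      using S by measurable
  next
    fix i w assume "w \<in> {0..\<tau> j}" "\<bar>w - \<omega> j i\<bar> \<le> \<delta> j"
    then show "- indicator ?S w \<le> (- indicator ?S (?left (\<omega> j i)) :: real)"
      by (auto simp: indicator_def)
  next
    fix i assume "i \<in> {1..N}"
    then show "\<exists>x\<in>{0..\<tau> j}. \<bar>x - \<omega> j i\<bar> \<le> \<delta> j
        \<and> - indicator ?S x = (- indicator ?S (?left (\<omega> j i)) :: real)"
      using left by blast
  qed (auto simp: indicator_def)
  moreover have "(SUP P\<in>?amb. ereal (\<integral>w. - indicator ?S w \<partial>P))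
      = (SUP P\<in>?amb. - ereal (measure P ?S))"
    by (intro SUP_cong) (simp_all add: sets_amb)
  moreover have "(SUP P\<in>?amb. - ereal (measure P ?S)) = - (INF P\<in>?amb. ereal (measure P ?S))"
    by (rule ereal_SUP_uminus_eq)
  ultimately have "- (INF P\<in>?amb. ereal (measure P ?S))
      = - ereal ((\<Sum>i = 1..N. indicator ?S (?left (\<omega> j i))) / real N)"
    by (simp only: sum_negf uminus_ereal.simps minus_divide_left)
  then have "(INF P\<in>?amb. ereal (measure P ?S))
      = ereal ((\<Sum>i = 1..N. of_bool (max 0 (real t - max (\<omega> j i - \<delta> j) 0) \<le> \<rho>)) / real N)"
    unfolding ereal_uminus_eq_iff by (simp add: indicator_def)
  then show "(of_bool ((INF P\<in>\<P> j. ereal (measure P ?S)) \<ge> ereal (1 - \<epsilon>)) :: real)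
        = of_bool ((\<Sum>i = 1..N. of_bool (max 0 (real t - max (\<omega> j i - \<delta> j) 0) \<le> \<rho>)) / real N
            \<ge> 1 - \<epsilon>)"
    by (simp only: ambiguity[OF j] ereal_less_eq)

  have "(SUP P\<in>?amb. ereal (\<integral>w. indicator {..real t} w \<partial>P))
      = ereal ((\<Sum>i = 1..N. indicator {..real t} (?left (\<omega> j i))) / real N)"
  proof (rule SUP_integral_wasserstein_ball[OF N \<Xi>, where M = 1])
    fix i w assume "w \<in> {0..\<tau> j}" "\<bar>w - \<omega> j i\<bar> \<le> \<delta> j"
    then show "indicator {..real t} w \<le> (indicator {..real t} (?left (\<omega> j i)) :: real)"
      by (auto simp: indicator_def)
  next
    fix i assume "i \<in> {1..N}"
    then show "\<exists>x\<in>{0..\<tau> j}. \<bar>x - \<omega> j i\<bar> \<le> \<delta> j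
        \<and> indicator {..real t} x = (indicator {..real t} (?left (\<omega> j i)) :: real)"
      using left by blast
  qed (auto simp: indicator_def)
  moreover have "(SUP P\<in>?amb. ereal (\<integral>w. indicator {..real t} w \<partial>P))
      = (SUP P\<in>?amb. ereal (measure P {w. w \<le> real t}))"
    by (intro SUP_cong) (simp_all add: sets_amb atMost_def)
  ultimately show "(SUP P\<in>\<P> j. ereal (measure P {w. w \<le> real t}))
        = ereal ((\<Sum>i = 1..N. of_bool (\<omega> j i - \<delta> j \<le> real t)) / real N)"
    by (simp add: ambiguity[OF j] indicator_def)
qed

end
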